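(* Let $m\ge1$, $r\in\mathbb{R}^m$, and for each $j$ let $J_j\subset\mathbb{R}$ be an interval with lower endpoint $\ell_j\in[-\infty,r_j)$ and upper endpoint $r_j\in J_j$. Let $K(y)=\prod_{j=1}^m k_j(y_j)$, where each $k_j\in L^1(J_j)$ is nonnegative and positive almost everywhere on $J_j$. Define $T_j(t)=\int_{\ell_j}^t k_j(s)\,ds$ for $t\in J_j$ and $T(y)=(T_1(y_1),\dots,T_m(y_m))$. Then for every finite set $A\subset\prod_j J_j$, $$\mathrm{WHV}_{K,r}(A)=\mathrm{HV}_{T(r)}(T(A)).$$ Moreover, suppose that the predictive model is Gaussian in transformed coordinates, i.e. the predictive vector in transformed coordinates is $U=(U_1,\dots,U_m)$ with independent $U_j\sim N(\mu_j,\sigma_j^2)$, $\sigma_j>0$, and the expected weighted hypervolume improvement is $$\mathcal{E}_A(\mu,\sigma)=\mathbb{E}\bigl[\mathrm{HV}_{T(r)}(T(A)\cup\{U\})-\mathrm{HV}_{T(r)}(T(A))\bigr].$$ Then: (1) (exact computation) with $\psi_j(c)=\mathbb{E}[(c-U_j)_+]$ and $\psi(c)=(\psi_1(c_1),\dots,\psi_m(c_m))$, $$\mathcal{E}_A(\mu,\sigma)=\mathrm{HV}_{\psi(T(r))}\bigl(\psi(T(A))\cup\{0\}\bigr)-\mathrm{HV}_{\psi(T(r))}\bigl(\psi(T(A))\bigr);$$ (2) (strict Pareto compliance) for all finite $A,B\subset\prod_jJ_j$ with $\mathrm{Dom}_r(B)\subseteq\mathrm{Dom}_r(A)$ and $\mathrm{Dom}_r(A)\setminus\mathrm{Dom}_r(B)$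 of positive Lebesgue measure, $\mathrm{WHV}_{K,r}(A)>\mathrm{WHV}_{K,r}(B)$; (3) (variance monotonicity) if $\sigma'_j\ge\sigma_j$ for all $j$, then $\mathcal{E}_A(\mu,\sigma')\ge\mathcal{E}_A(\mu,\sigma)$.
   Context: Minimization convention. For finite $A\subset\mathbb{R}^m$ and $r\in\mathbb{R}^m$: $\mathrm{Dom}_r(A)=\bigcup_{a\in A}[a_1,r_1]\times\cdots\times[a_m,r_m]$ (a box being empty if $a_j>r_j$ for some $j$), $\mathrm{HV}_r(A)=\int_{\mathrm{Dom}_r(A)}1\,dy$, and for a density $K$, $\mathrm{WHV}_{K,r}(A)=\int_{\mathrm{Dom}_r(A)}K(y)\,dy$. For a set $A$ and a map $T$, $T(A)=\{T(a):a\in A\}$; $(u)_+=\max\{u,0\}$. *)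

theory Defs
  imports "HOL-Probability.Probability"
begin

(* Minimization: cbox a r is the coordinatewise box [a, r], empty if a $ j > r $ j for some j. *)
definition Dom :: "real ^ 'm \<Rightarrow> (real ^ 'm) set \<Rightarrow> (real ^ 'm) set" where
  "Dom r A = (\<Union>a\<in>A. cbox a r)"

definition HV :: "real ^ 'm \<Rightarrow> (real ^ 'm) set \<Rightarrow> real" where
  "HV r A = (LINT y:Dom r A|lebesgue. 1)"

definition WHV :: "(real ^ 'm \<Rightarrow> real) \<Rightarrow> real ^ 'm \<Rightarrow> (real ^ 'm) set \<Rightarrow> real" where
  "WHV K r A = (LINT y:Dom r A|lebesgue. K y)"

definition prod_density :: "('m::finite \<Rightarrow> real \<Rightarrow> real) \<Rightarrow> real ^ 'm \<Rightarrow> real" where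
  "prod_density k y = (\<Prod>j\<in>UNIV. k j (y $ j))"

(* The integral is taken over lebesgue, not lborel: the k j are only assumed Lebesgue
   measurable, and an integral of a non-Borel function over lborel is 0 by convention. *)
definition cumul ::
  "('m::finite \<Rightarrow> ereal) \<Rightarrow> ('m \<Rightarrow> real \<Rightarrow> real) \<Rightarrow> real ^ 'm \<Rightarrow> real ^ 'm" where
  "cumul l k y = (\<chi> j. (LINT s=l j..ereal (y $ j)|lebesgue. k j s))"

(* sigma $ j is the standard deviation of the j-th component. *)
definition indep_gaussian ::
  "'a measure \<Rightarrow> ('a \<Rightarrow> real ^ 'm) \<Rightarrow> real ^ 'm \<Rightarrow> real ^ 'm \<Rightarrow> bool" where
  "indep_gaussian M U \<mu> \<sigma> \<longleftrightarrow>
     prob_space M \<and>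
     prob_space.indep_vars M (\<lambda>_. borel) (\<lambda>j \<omega>. U \<omega> $ j) UNIV \<and>
     (\<forall>j. distributed M lborel (\<lambda>\<omega>. U \<omega> $ j) (normal_density (\<mu> $ j) (\<sigma> $ j)))"

(* For U with indep_gaussian M U \<mu> \<sigma> this depends on M and U only through (\<mu>, \<sigma>);
   instantiated at the transformed reference point T r and front T ` A it is the
   expected weighted hypervolume improvement. *)
definition expected_HVI ::
  "'a measure \<Rightarrow> ('a \<Rightarrow> real ^ 'm) \<Rightarrow> real ^ 'm \<Rightarrow> (real ^ 'm) set \<Rightarrow> real" where
  "expected_HVI M U r A = (LINT \<omega>|M. HV r (A \<union> {U \<omega>}) - HV r A)"

definition psi :: "'a measure \<Rightarrow> ('a \<Rightarrow> real ^ 'm) \<Rightarrow> real ^ 'm \<Rightarrow> real ^ 'm" where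
  "psi M U c = (\<chi> j. (LINT \<omega>|M. max (c $ j - U \<omega> $ j) 0))"

end

theory Submission imports Defs begin

text \<open>
Two boxes \<open>[a, r]\<close> and \<open>[b, r]\<close> with a common upper corner meet in the box \<open>[sup a b, r]\<close>. Hence every
additive function of dominated regions satisfies
\<open>F (insert a A) = F {a} + F A - F (sup a ` A)\<close>, and this recursion (\<open>WHV_insert\<close>, \<open>HV_insert\<close>,
with the induction principle \<open>sup_image_induct\<close>) determines \<open>F\<close> on all finite fronts from its values
on single boxes. If a map preserves suprema, as coordinatewise monotone maps do, then an identity
between the volume of a single box and that of its image extends to all finite fronts.

This is used twice. For the weighted hypervolume the map is \<open>T\<close>: by Fubini the integral of a product density over
\<open>[a, r]\<close> is the product of the numbers \<open>T r $ j - T a $ j\<close> (\<open>prod_density_box\<close>, \<open>interval_integral_diff\<close>).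
For the expected improvement the map is \<open>\<psi>\<close>: a sample \<open>u\<close> improves the front by the volume of \<open>[u, R]\<close>
minus the volume that \<open>[u, R]\<close> shares with the dominated region, and the expected volume shared with a
single box \<open>[a, R]\<close> is the volume of \<open>[\<psi> a, \<psi> R]\<close> (\<open>expectation_HV_sup\<close>). The expected improvement is
therefore the volume of \<open>[0, \<psi> R]\<close> minus the hypervolume of the front \<open>\<psi> A\<close>; adding the point 0
to that front makes it dominate all of \<open>[0, \<psi> R]\<close>.

Monotonicity in the standard deviations follows from this formula. The complement in \<open>[0, \<psi> R]\<close> of the region
dominated by \<open>\<psi> A\<close> grows, as a set, when \<open>\<psi>\<close> grows pointwise (\<open>expected_HVI_mono\<close>), and the
expected shortfall of a Gaussian below a fixed level increases with its standard deviation
(\<open>expected_shortfall_gaussian_mono\<close>). Strict Pareto compliance holds because the difference of the two weighted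
hypervolumes is the integral of an almost everywhere positive density over a set of positive measure.
\<close>

section \<open>Volumes of unions of boxes with a common corner\<close>

text \<open>The recursion behind inclusion-exclusion for unions of boxes with a common upper corner:
adding the corner \<open>a\<close> changes the volume by one box and by the family of corners \<open>sup a b\<close>,
which has no more members than the family one started from. A property stable under this step
therefore needs checking only for one box, and no alternating sums occur. The set \<open>X\<close> confines
the corners to where the property is meaningful.\<close>

lemma sup_image_induct [consumes 2, case_names empty singleton insert]:
  fixes A :: "'a::semilattice_sup set"
  assumes "finite A" and "A \<subseteq> X"
    and empty: "P {}"
    and singleton: "\<And>a. a \<in> X \<Longrightarrow> P {a}"
    and insert: "\<And>a A. \<lbrakk>a \<in> X; finite A; A \<subseteq> X; P {a}; P A; P (sup a ` A)\<rbrakk> \<Longrightarrow> P (insert a A)"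
    and closed: "\<And>a b. \<lbrakk>a \<in> X; b \<in> X\<rbrakk> \<Longrightarrow> sup a b \<in> X"
  shows "P A"
  using assms(1,2)
proof (induction "card A" arbitrary: A rule: less_induct)
  case less
  show ?case
  proof (cases "A = {}")
    case False
    then obtain a B where A: "A = insert a B" "a \<notin> B"
      by (meson mk_disjoint_insert ex_in_conv)
    then have fin: "finite B" and X: "a \<in> X" "B \<subseteq> X" and card: "card B < card A"
      using less.prems by auto
    have "P B" "P (sup a ` B)"
      using less.hyps[of B] less.hyps[of "sup a ` B"] card fin X closed card_image_le[OF fin, of "sup a"]
      by auto
    then show ?thesis
      unfolding A(1) using insert fin X singleton by blast
  qed (use empty in simp)
qed

text \<open>Both coordinate changes of this theory, the integrated density and the expected shortfall, act
on each coordinate by a monotone function. Such a map carries the corner of an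
intersection of boxes to the corner of the intersection of the transformed boxes.\<close>

lemma vec_lambda_sup:
  fixes g :: "'m::finite \<Rightarrow> real \<Rightarrow> real"
  assumes "\<And>j. mono_on (S j) (g j)" and "\<And>j. a $ j \<in> S j" "\<And>j. b $ j \<in> S j"
  shows "(\<chi> j. g j (sup a b $ j)) = sup (\<chi> j. g j (a $ j)) (\<chi> j. g j (b $ j))"
proof -
  have "g j (sup (a $ j) (b $ j)) = sup (g j (a $ j)) (g j (b $ j))" for j
    using assms mono_onD[of "S j" "g j" "a $ j" "b $ j"] mono_onD[of "S j" "g j" "b $ j" "a $ j"]
    by (cases "a $ j \<le> b $ j") (auto simp: sup_absorb1 sup_absorb2)
  then show ?thesis
    by (simp add: vec_eq_iff sup_vec_def)
qed

lemma Dom_empty [simp]: "Dom r {} = {}"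
  by (simp add: Dom_def)

lemma Dom_singleton [simp]: "Dom r {a} = cbox a r"
  by (simp add: Dom_def)

lemma Dom_insert: "Dom r (insert a A) = cbox a r \<union> Dom r A"
  by (simp add: Dom_def)

text \<open>Two boxes ending in \<open>r\<close> meet in the box that starts at the supremum of their corners, so
intersecting with one box keeps the shape of a dominated region.\<close>

lemma cbox_Int_Dom: "cbox a r \<inter> Dom r A = Dom r (sup a ` A)"
  by (auto simp: Dom_def mem_box_cart sup_vec_def)

lemma lmeasurable_Dom: "finite A \<Longrightarrow> Dom r A \<in> lmeasurable"
  unfolding Dom_def by (intro fmeasurable.finite_UN) auto

lemma absolutely_integrable_on_Dom:
  fixes K :: "real ^ 'm \<Rightarrow> real"
  assumes "finite A" and "\<And>a. a \<in> A \<Longrightarrow> K absolutely_integrable_on cbox a r"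
  shows "K absolutely_integrable_on Dom r A"
  using assms
  by (induction rule: finite_induct) (auto simp: Dom_insert intro: absolutely_integrable_Un)

lemma set_integral_Un_Int:
  fixes f :: "'a \<Rightarrow> real"
  assumes S: "set_integrable M S f" and T: "set_integrable M T f"
    and sets: "S \<in> sets M" "T \<in> sets M"
  shows "(LINT x:S \<union> T|M. f x) = (LINT x:S|M. f x) + (LINT x:T|M. f x) - (LINT x:S \<inter> T|M. f x)"
proof -
  have T': "set_integrable M (T - S) f" "set_integrable M (S \<inter> T) f"
    using set_integrable_subset[OF T] sets by auto
  have "(LINT x:S \<union> (T - S)|M. f x) = (LINT x:S|M. f x) + (LINT x:T - S|M. f x)"
    by (intro set_integral_Un S T') auto
  moreover have "(LINT x:(S \<inter> T) \<union> (T - S)|M. f x) = (LINT x:S \<inter> T|M. f x) + (LINT x:T - S|M. f x)"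
    by (intro set_integral_Un T') auto
  moreover have "(S \<inter> T) \<union> (T - S) = T" by auto
  ultimately show ?thesis by simp
qed

lemma WHV_insert:
  assumes "finite A" and "\<And>b. b \<in> insert a A \<Longrightarrow> K absolutely_integrable_on cbox b r"
  shows "WHV K r (insert a A) = WHV K r {a} + WHV K r A - WHV K r (sup a ` A)"
  unfolding WHV_def Dom_insert[of r a A] Dom_singleton cbox_Int_Dom[symmetric]
  using assms by (intro set_integral_Un_Int absolutely_integrable_on_Dom) (auto simp: lmeasurable_Dom fmeasurableD)

lemma HV_eq_measure: "finite A \<Longrightarrow> HV r A = measure lebesgue (Dom r A)"
  using lmeasurable_Dom by (simp add: HV_def set_lebesgue_integral_def fmeasurableD)

lemma HV_empty [simp]: "HV r {} = 0"
  by (simp add: HV_eq_measure)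

lemma HV_insert: "finite A \<Longrightarrow> HV r (insert a A) = HV r {a} + HV r A - HV r (sup a ` A)"
  using WHV_insert[where K = "\<lambda>_. 1"] lmeasurable_Dom
  by (simp add: HV_def WHV_def absolutely_integrable_on_const)

text \<open>The positive parts cover the degenerate boxes, which occur as \<open>cbox (sup u a) r\<close> when a
random sample \<open>u\<close> exceeds the reference point in some coordinate.\<close>

lemma HV_singleton: "HV r {a} = (\<Prod>j\<in>UNIV. max (r $ j - a $ j) 0)"
proof -
  have "HV r {a} = measure lborel (cbox a r)"
    by (simp add: HV_eq_measure)
  also have "\<dots> = (\<Prod>j\<in>UNIV. max (r $ j - a $ j) 0)"
  proof (cases "\<forall>j. a $ j \<le> r $ j")
    case True
    then have "cbox a r \<noteq> {}" by (simp add: interval_ne_empty_cart)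
    then show ?thesis using True by (simp add: content_cbox_cart)
  next
    case False
    then obtain j where "a $ j > r $ j" by (meson not_le)
    then have "cbox a r = {}" "max (r $ j - a $ j) 0 = 0" by (auto simp: interval_eq_empty_cart)
    then show ?thesis by (metis (no_types, lifting) content_empty finite iso_tuple_UNIV_I prod_zero)
  qed
  finally show ?thesis .
qed

section \<open>Product densities on boxes\<close>

lemma measurable_vec_lambda [measurable]:
  "(\<lambda>f. \<chi> j. f j) \<in> (\<Pi>\<^sub>M j\<in>(UNIV :: 'm::finite set). (lborel :: real measure)) \<rightarrow>\<^sub>M (borel :: (real ^ 'm) measure)"
  by (subst borel_measurable_euclidean_space) (auto simp: Basis_vec_def inner_axis)

lemma lborel_vec_eq:
  "(lborel :: (real ^ 'm) measure) = distr (\<Pi>\<^sub>M j\<in>(UNIV :: 'm::finite set). lborel) borel (\<lambda>f. \<chi> j. f j)"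
proof (rule lborel_eqI)
  interpret product_sigma_finite "\<lambda>_::'m. lborel :: real measure" ..
  fix l u :: "real ^ 'm"
  assume le: "\<And>b. b \<in> Basis \<Longrightarrow> l \<bullet> b \<le> u \<bullet> b"
  have le': "l $ j \<le> u $ j" for j
    using le[of "axis j 1"] by (simp add: inner_axis axis_in_Basis_iff)
  have "(\<lambda>f. \<chi> j. f j) -` box l u \<inter> space (\<Pi>\<^sub>M j\<in>(UNIV :: 'm set). lborel) = (\<Pi>\<^sub>E j\<in>UNIV. {l $ j<..<u $ j})"
    by (auto simp: space_PiM mem_box_cart PiE_iff)
  then have "emeasure (distr (\<Pi>\<^sub>M j\<in>(UNIV :: 'm set). lborel) borel (\<lambda>f. \<chi> j. f j)) (box l u)
      = (\<Prod>j\<in>UNIV. emeasure lborel {l $ j<..<u $ j})"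
    by (simp add: emeasure_distr emeasure_PiM)
  also have "\<dots> = (\<Prod>j\<in>UNIV. u $ j - l $ j)"
    using le' by (simp add: prod_ennreal)
  also have "(\<Prod>j\<in>UNIV. u $ j - l $ j) = (\<Prod>b\<in>Basis. (u - l) \<bullet> b)"
    by (simp add: Basis_vec_def cart_eq_inner_axis axis_eq_axis prod.UNION_disjoint inner_diff_left)
  finally show "emeasure (distr (\<Pi>\<^sub>M j\<in>(UNIV :: 'm set). lborel) borel (\<lambda>f. \<chi> j. f j)) (box l u)
      = (\<Prod>b\<in>Basis. (u - l) \<bullet> b)" .
qed simp

text \<open>Almost-everywhere statements about the one-dimensional densities are lifted to vectors through
this fact. The exceptional set is first enlarged to a Borel null set, because the product
description of the measure is available for Borel sets only; the preimage is then a
product with one null factor.\<close>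

lemma negligible_vec_preimage:
  assumes "negligible N"
  shows "negligible {y :: real ^ 'm. y $ j \<in> N}"
proof -
  interpret product_sigma_finite "\<lambda>_::'m. lborel :: real measure" ..
  obtain N' where N': "N' \<in> null_sets lborel" "N \<subseteq> N'"
    using assms by (auto simp: negligible_iff_null_sets null_sets_completion_iff2)
  then have [measurable]: "N' \<in> sets borel" by auto
  let ?Y = "\<lambda>i. if i = j then N' else UNIV"
  have "(\<lambda>f. \<chi> i. f i) -` {y. y $ j \<in> N'} \<inter> space (\<Pi>\<^sub>M i\<in>(UNIV :: 'm set). lborel) = (\<Pi>\<^sub>E i\<in>UNIV. ?Y i)"
    by (auto simp: space_PiM PiE_iff split: if_splits)
  moreover have meas: "{y :: real ^ 'm. y $ j \<in> N'} \<in> sets borel"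
    by measurable
  ultimately have "emeasure lborel {y :: real ^ 'm. y $ j \<in> N'} = (\<Prod>i\<in>UNIV. emeasure lborel (?Y i))"
    by (simp add: lborel_vec_eq[where 'm='m] emeasure_distr emeasure_PiM)
  also have "\<dots> = 0"
    using N' by (intro prod_zero bexI[of _ j]) auto
  finally have "{y :: real ^ 'm. y $ j \<in> N'} \<in> null_sets lborel"
    using meas by (simp add: null_sets_def)
  then show ?thesis
    using N'(2) unfolding negligible_iff_null_sets null_sets_completion_iff2
    by (intro bexI) auto
qed

lemma prod_integral_lborel:
  fixes g :: "'m::finite \<Rightarrow> real \<Rightarrow> real"
  assumes g: "\<And>j. integrable lborel (g j)"
  shows "has_bochner_integral lborel (\<lambda>y :: real ^ 'm. \<Prod>j\<in>UNIV. g j (y $ j)) (\<Prod>j\<in>UNIV. integral\<^sup>L lborel (g j))"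
proof -
  interpret product_sigma_finite "\<lambda>_::'m. lborel :: real measure" ..
  have [measurable]: "g j \<in> borel_measurable borel" for j
    using borel_measurable_integrable[OF g] by simp
  show ?thesis
    unfolding has_bochner_integral_iff lborel_vec_eq[where 'm='m]
    using product_integrable_prod[of UNIV g] product_integral_prod[of UNIV g] g
    by (simp add: integrable_distr_eq integral_distr)
qed

text \<open>The factors are only Lebesgue measurable, whereas Fubini's theorem concerns the product of Borel
measures. Each factor, cut off outside its interval, is replaced by a Borel
function that agrees with it almost everywhere; the products then agree off a union of finitely many
null cylinders, which neither integrability nor the integral can see.\<close>

lemma prod_density_box:
  fixes k :: "'m::finite \<Rightarrow> real \<Rightarrow> real" and a r :: "real ^ 'm"
  assumes k: "\<And>j. k j absolutely_integrable_on {a $ j..r $ j}"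
  shows "prod_density k absolutely_integrable_on cbox a r"
    and "(LINT y:cbox a r|lebesgue. prod_density k y) = (\<Prod>j\<in>UNIV. integral {a $ j..r $ j} (k j))"
proof -
  define f where "f = (\<lambda>j x. indicator {a $ j..r $ j} x *\<^sub>R k j x)"
  have f: "integrable lebesgue (f j)" for j
    using k[of j] by (simp add: f_def set_integrable_def)
  have "\<forall>j. \<exists>g. g \<in> borel_measurable borel \<and> (AE x in lborel. f j x = g x)"
    using completion_ex_borel_measurable_real[OF borel_measurable_integrable[OF f]] by auto
  then obtain g where g[measurable]: "\<And>j. g j \<in> borel_measurable borel"
    and fg: "\<And>j. AE x in lborel. f j x = g j x"
    unfolding choice_iff by auto
  have fg': "AE x in lebesgue. f j x = g j x" for j
    using fg by (rule AE_completion)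
  have g_leb: "g j \<in> borel_measurable lebesgue" for j
    by (simp add: measurable_completion)
  have int_g: "integrable lborel (g j)" and int_eq: "integral\<^sup>L lborel (g j) = integral {a $ j..r $ j} (k j)" for j
  proof -
    have "integrable lebesgue (g j)"
      using integrable_cong_AE[OF borel_measurable_integrable[OF f] g_leb fg'] f by simp
    then show "integrable lborel (g j)"
      by (simp add: integrable_completion)
    have "integral\<^sup>L lborel (g j) = integral\<^sup>L lebesgue (f j)"
      using integral_cong_AE[OF borel_measurable_integrable[OF f] g_leb fg'] by (simp add: integral_completion)
    also have "\<dots> = integral {a $ j..r $ j} (k j)"
      using set_lebesgue_integral_eq_integral(2)[OF k] by (simp add: f_def set_lebesgue_integral_def)
    finally show "integral\<^sup>L lborel (g j) = integral {a $ j..r $ j} (k j)" .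
  qed
  define G where "G = (\<lambda>y :: real ^ 'm. \<Prod>j\<in>UNIV. g j (y $ j))"
  have G: "has_bochner_integral lborel G (\<Prod>j\<in>UNIV. integral {a $ j..r $ j} (k j))"
    using prod_integral_lborel[OF int_g] by (simp add: G_def int_eq)
  have [measurable]: "G \<in> borel_measurable borel"
    unfolding G_def by measurable
  have G_abs: "G absolutely_integrable_on UNIV"
    using G by (simp add: set_integrable_def integrable_completion has_bochner_integral_iff)
  have G_int: "integral UNIV G = (\<Prod>j\<in>UNIV. integral {a $ j..r $ j} (k j))"
    using set_lebesgue_integral_eq_integral(2)[OF G_abs] G
    by (simp add: set_lebesgue_integral_def integral_completion has_bochner_integral_iff)
  define N where "N = (\<Union>j. {y :: real ^ 'm. y $ j \<in> {x. f j x \<noteq> g j x}})"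
  have "negligible {x. f j x \<noteq> g j x}" for j
    using fg[of j] by (auto simp: eventually_ae_filter negligible_iff_null_sets null_sets_completion_iff2)
  then have "negligible {y :: real ^ 'm. y $ j \<in> {x. f j x \<noteq> g j x}}" for j
    by (rule negligible_vec_preimage)
  then have N: "negligible N"
    unfolding N_def by (intro negligible_Union) auto
  have eq: "(if y \<in> cbox a r then prod_density k y else 0) = G y" if "y \<in> UNIV - N" for y
  proof -
    have "G y = (\<Prod>j\<in>UNIV. f j (y $ j))"
      using that by (auto simp: G_def N_def)
    also have "\<dots> = (if y \<in> cbox a r then prod_density k y else 0)"
      by (auto simp: f_def prod_density_def mem_box_cart indicator_def intro!: prod_zero)
    finally show ?thesis by simp
  qed
  have "(\<lambda>y. if y \<in> cbox a r then prod_density k y else 0) absolutely_integrable_on UNIV"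
    using absolutely_integrable_spike[OF G_abs N eq] by simp
  then show abs: "prod_density k absolutely_integrable_on cbox a r"
    by (simp add: absolutely_integrable_restrict_UNIV)
  show "(LINT y:cbox a r|lebesgue. prod_density k y) = (\<Prod>j\<in>UNIV. integral {a $ j..r $ j} (k j))"
    unfolding set_lebesgue_integral_eq_integral(2)[OF abs] G_int[symmetric]
    using integral_spike[OF N eq] by (simp add: integral_restrict_UNIV)
qed

section \<open>The expected hypervolume of a random front\<close>

lemma expectation_prod_indep:
  fixes U :: "'a \<Rightarrow> real ^ 'm" and f :: "'m \<Rightarrow> real \<Rightarrow> real"
  assumes "prob_space M"
    and indep: "prob_space.indep_vars M (\<lambda>_. borel) (\<lambda>j \<omega>. U \<omega> $ j) UNIV"
    and meas: "\<And>j. f j \<in> borel_measurable borel"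
    and int: "\<And>j. integrable M (\<lambda>\<omega>. f j (U \<omega> $ j))"
  shows "has_bochner_integral M (\<lambda>\<omega>. \<Prod>j\<in>UNIV. f j (U \<omega> $ j)) (\<Prod>j\<in>UNIV. \<integral>\<omega>. f j (U \<omega> $ j) \<partial>M)"
proof -
  interpret prob_space M by fact
  have "indep_vars (\<lambda>_. borel) (\<lambda>j \<omega>. f j (U \<omega> $ j)) UNIV"
    using indep_vars_compose2[OF indep, of f "\<lambda>_. borel"] meas by simp
  then show ?thesis
    using int by (simp add: has_bochner_integral_iff indep_vars_lebesgue_integral indep_vars_integrable)
qed

lemma (in prob_space) integrable_pos_part:
  fixes X :: "'a \<Rightarrow> real"
  shows "integrable M X \<Longrightarrow> integrable M (\<lambda>\<omega>. max (c - X \<omega>) 0)"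
  by (intro Bochner_Integration.integrable_max Bochner_Integration.integrable_diff) auto

text \<open>Integrability makes the expected shortfalls \<open>\<psi>\<close> finite, and independence lets the expectation of a
box volume factor over the coordinates.\<close>

locale indep_integrable_vector = prob_space M
  for M :: "'a measure" +
  fixes U :: "'a \<Rightarrow> real ^ 'm"
  assumes indep: "indep_vars (\<lambda>_. borel) (\<lambda>j \<omega>. U \<omega> $ j) UNIV"
    and integrable_nth: "\<And>j. integrable M (\<lambda>\<omega>. U \<omega> $ j)"
begin

lemma integrable_shortfall: "integrable M (\<lambda>\<omega>. max (c - U \<omega> $ j) 0)"
  by (intro integrable_pos_part integrable_nth)

lemma psi_nth_mono: "c $ j \<le> d $ j \<Longrightarrow> psi M U c $ j \<le> psi M U d $ j"
  by (auto simp: psi_def intro!: integral_mono integrable_shortfall)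

lemma psi_nonneg: "0 \<le> psi M U c"
  by (auto simp: psi_def less_eq_vec_def intro!: integral_nonneg_AE)

lemma psi_sup: "psi M U (sup c d) = sup (psi M U c) (psi M U d)"
  unfolding psi_def
  by (rule vec_lambda_sup[where S = "\<lambda>_. UNIV"])
    (auto simp: mono_on_def intro!: integral_mono integrable_shortfall)

text \<open>For \<open>a \<le> R\<close>, the part of \<open>[a, R]\<close> above \<open>u\<close> has length \<open>(R - max u a)\<^sub>+ = (R - u)\<^sub>+ - (a - u)\<^sub>+\<close>
in each coordinate. Taking expectations turns this into \<open>\<psi> R - \<psi> a\<close>, and independence multiplies
the coordinates, so the expected volume is again the volume of a box, with both corners moved
by \<open>\<psi>\<close>. Without \<open>a \<le> R\<close> the length identity fails.\<close>

lemma expectation_HV_sup_singleton: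
  assumes "a \<le> R"
  shows "has_bochner_integral M (\<lambda>\<omega>. HV R {sup (U \<omega>) a}) (HV (psi M U R) {psi M U a})"
proof -
  have le: "a $ j \<le> R $ j" for j
    using assms by (simp add: less_eq_vec_def)
  let ?f = "\<lambda>j u. max (R $ j - u) 0 - max (a $ j - u) 0"
  have eq: "max (R $ j - sup u a $ j) 0 = ?f j (u $ j)" for j and u :: "real ^ 'm"
    using le[of j] by (auto simp: sup_vec_def sup_max max_def)
  have "(\<integral>\<omega>. ?f j (U \<omega> $ j) \<partial>M) = max (psi M U R $ j - psi M U a $ j) 0" for j
    using psi_nth_mono[OF le] integrable_shortfall by (simp add: psi_def Bochner_Integration.integral_diff)
  moreover have "has_bochner_integral M (\<lambda>\<omega>. \<Prod>j\<in>UNIV. ?f j (U \<omega> $ j)) (\<Prod>j\<in>UNIV. \<integral>\<omega>. ?f j (U \<omega> $ j) \<partial>M)"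
    by (rule expectation_prod_indep[OF prob_space_axioms indep]) (use integrable_shortfall in auto)
  ultimately show ?thesis
    by (simp add: HV_singleton eq)
qed

text \<open>The point 0 appears as the limit of \<open>\<psi> a\<close> when all coordinates of \<open>a\<close> tend to \<open>- \<infinity>\<close>: the box \<open>[U \<omega>, R]\<close>
is what the random point shares with the whole orthant below \<open>R\<close>.\<close>

lemma expectation_HV_single:
  "has_bochner_integral M (\<lambda>\<omega>. HV R {U \<omega>}) (HV (psi M U R) {0})"
proof -
  have "has_bochner_integral M (\<lambda>\<omega>. \<Prod>j\<in>UNIV. max (R $ j - U \<omega> $ j) 0)
      (\<Prod>j\<in>UNIV. \<integral>\<omega>. max (R $ j - U \<omega> $ j) 0 \<partial>M)"
    by (rule expectation_prod_indep[OF prob_space_axioms indep]) (use integrable_shortfall in auto)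
  moreover have "(\<integral>\<omega>. max (R $ j - U \<omega> $ j) 0 \<partial>M) = max (psi M U R $ j) 0" for j
    using psi_nonneg[of R] by (simp add: less_eq_vec_def psi_def)
  ultimately show ?thesis
    by (simp add: HV_singleton)
qed

text \<open>The set \<open>sup (U \<omega>) ` A\<close> dominates what the random box \<open>[U \<omega>, R]\<close> has in common with the region
dominated by \<open>A\<close>. Since \<open>\<psi>\<close> preserves suprema, both sides obey the same recursion, and
so the identity for one box spreads to all finite fronts.\<close>

lemma expectation_HV_sup:
  assumes "finite A" "A \<subseteq> {..R}"
  shows "has_bochner_integral M (\<lambda>\<omega>. HV R (sup (U \<omega>) ` A)) (HV (psi M U R) (psi M U ` A))"
  using assms
proof (induction A rule: sup_image_induct)
  case (singleton a)
  then show ?case using expectation_HV_sup_singleton[of a R] by simp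
next
  case (insert a A)
  have 1: "HV R (sup u ` insert a A) = HV R (sup u ` {a}) + HV R (sup u ` A) - HV R (sup u ` sup a ` A)" for u
  proof -
    have "sup (sup u a) ` sup u ` A = sup u ` sup a ` A"
      by (simp add: image_image sup_left_commute sup_assoc)
    then show ?thesis
      using HV_insert[of "sup u ` A" R "sup u a"] insert.hyps by simp
  qed
  have 2: "HV (psi M U R) (psi M U ` insert a A)
      = HV (psi M U R) (psi M U ` {a}) + HV (psi M U R) (psi M U ` A) - HV (psi M U R) (psi M U ` sup a ` A)"
    using HV_insert[of "psi M U ` A"] insert.hyps by (simp add: image_image psi_sup)
  show ?case
    unfolding 1 2 by (intro has_bochner_integral_add has_bochner_integral_diff insert.IH)
qed auto

lemma expected_HVI_eq:
  assumes A: "finite A" "A \<subseteq> {..R}"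
  shows "expected_HVI M U R A = HV (psi M U R) {0} - HV (psi M U R) (psi M U ` A)"
proof -
  have "HV R (A \<union> {u}) - HV R A = HV R {u} - HV R (sup u ` A)" for u
    using HV_insert[OF A(1), of R u] by simp
  then show ?thesis
    unfolding expected_HVI_def
    using has_bochner_integral_diff[OF expectation_HV_single[of R] expectation_HV_sup[OF A]]
    by (simp add: has_bochner_integral_iff)
qed

text \<open>The improvement as the volume of one explicit set. In this form, comparing two models reduces to
an inclusion of sets.\<close>

lemma expected_HVI_eq_measure:
  assumes A: "finite A" "A \<subseteq> {..R}"
  shows "expected_HVI M U R A = measure lebesgue (cbox 0 (psi M U R) - Dom (psi M U R) (psi M U ` A))"
proof -
  let ?D = "Dom (psi M U R) (psi M U ` A)"
  have sub: "?D \<subseteq> cbox 0 (psi M U R)"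
    using psi_nonneg by (fastforce simp: Dom_def mem_box_cart less_eq_vec_def intro: order_trans)
  have "measure lebesgue (cbox 0 (psi M U R) - ?D) = measure lebesgue (cbox 0 (psi M U R)) - measure lebesgue ?D"
    using A sub by (intro measurable_measure_Diff) (auto simp: lmeasurable_Dom fmeasurableD)
  then show ?thesis
    unfolding expected_HVI_eq[OF A] using A by (simp add: HV_eq_measure)
qed

end

text \<open>The front \<open>B\<close> will be \<open>\<psi> (T A)\<close>, which lies in the nonnegative orthant, so that the added point 0
dominates everything that \<open>B\<close> does.\<close>

lemma HV_Un_zero:
  assumes "finite B" and "\<And>b. b \<in> B \<Longrightarrow> 0 \<le> b"
  shows "HV c (B \<union> {0}) = HV c {0}"
proof -
  have "Dom c B \<subseteq> cbox 0 c"
    using assms(2) by (fastforce simp: Dom_def mem_box_cart less_eq_vec_def intro: order_trans)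
  then show ?thesis
    using assms(1) by (simp add: HV_eq_measure Dom_insert sup.absorb1)
qed

text \<open>A point of \<open>[0, \<psi> R]\<close> stays undominated when the corners \<open>\<psi> a\<close> move up, and it stays inside the
box when \<open>\<psi> R\<close> moves up. Hence a larger \<open>\<psi>\<close> yields a larger set, although the hypervolume subtracted in
the formula grows as well.\<close>

lemma expected_HVI_mono:
  assumes U: "indep_integrable_vector M U" and U': "indep_integrable_vector M' U'"
    and le: "\<And>c. psi M U c \<le> psi M' U' c"
    and A: "finite A" "A \<subseteq> {..R}"
  shows "expected_HVI M U R A \<le> expected_HVI M' U' R A"
proof -
  interpret U: indep_integrable_vector M U by fact
  interpret U': indep_integrable_vector M' U' by fact
  show ?thesis
    unfolding U.expected_HVI_eq_measure[OF A] U'.expected_HVI_eq_measure[OF A]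
  proof (rule measure_mono_fmeasurable)
    show "cbox 0 (psi M U R) - Dom (psi M U R) (psi M U ` A) \<subseteq> cbox 0 (psi M' U' R) - Dom (psi M' U' R) (psi M' U' ` A)"
      using le by (fastforce simp: Dom_def mem_box_cart less_eq_vec_def intro: order_trans)
  qed (use A in \<open>auto simp: lmeasurable_Dom fmeasurableD intro!: fmeasurable.Diff\<close>)
qed

section \<open>Monotonicity in the standard deviation\<close>

lemma expected_shortfall_gaussian:
  assumes "prob_space M" and \<sigma>: "0 < \<sigma>"
    and X: "distributed M lborel X (normal_density \<mu> \<sigma>)"
  shows "has_bochner_integral lborel (\<lambda>z. std_normal_density z * max (c - \<mu> - \<sigma> * z) 0) (\<integral>\<omega>. max (c - X \<omega>) 0 \<partial>M)"
proof -
  interpret prob_space M by fact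
  let ?g = "\<lambda>z. max (c - \<mu> - \<sigma> * z) 0"
  have Z: "distributed M lborel (\<lambda>\<omega>. (X \<omega> - \<mu>) / \<sigma>) std_normal_density"
    using X normal_standard_normal_convert[OF \<sigma>] by simp
  have eq: "?g ((X \<omega> - \<mu>) / \<sigma>) = max (c - X \<omega>) 0" for \<omega>
    using \<sigma> by simp
  have "integrable M X"
    using distributed_integrable_var[OF X] integrable_normal_moment_nz_1[OF \<sigma>] by simp
  then have "integrable M (\<lambda>\<omega>. max (c - X \<omega>) 0)"
    by (rule integrable_pos_part)
  then show ?thesis
    using distributed_integral[OF Z, of ?g] distributed_integrable[OF Z, of ?g] \<sigma>
    by (simp add: has_bochner_integral_iff eq)
qed

text \<open>With \<open>X = \<mu> + \<sigma> Z\<close> and \<open>d = c - \<mu>\<close>, the integrand \<open>(d - \<sigma> z)\<^sub>+\<close> is not monotone in \<open>\<sigma>\<close> for fixed \<open>z\<close>.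
By the symmetry of \<open>Z\<close> one may average over \<open>z\<close> and \<open>- z\<close>, and \<open>(d - \<sigma> z)\<^sub>+ + (d + \<sigma> z)\<^sub>+\<close>
is a convex even function of \<open>\<sigma> z\<close>, hence increasing in \<open>\<sigma> \<ge> 0\<close>.\<close>

lemma expected_shortfall_gaussian_mono:
  assumes "prob_space M" "0 < \<sigma>" and X: "distributed M lborel X (normal_density \<mu> \<sigma>)"
    and "prob_space M'" "\<sigma> \<le> \<sigma>'" and X': "distributed M' lborel X' (normal_density \<mu> \<sigma>')"
  shows "(\<integral>\<omega>. max (c - X \<omega>) 0 \<partial>M) \<le> (\<integral>\<omega>. max (c - X' \<omega>) 0 \<partial>M')"
proof -
  have sym: "has_bochner_integral lborel
      (\<lambda>z. std_normal_density z * (max (c - \<mu> - s * z) 0 + max (c - \<mu> + s * z) 0)) (2 * i)"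
    if "has_bochner_integral lborel (\<lambda>z. std_normal_density z * max (c - \<mu> - s * z) 0) i" for s i
  proof -
    have "has_bochner_integral lborel (\<lambda>z. std_normal_density z * max (c - \<mu> + s * z) 0) i"
      using lborel_has_bochner_integral_real_affine_iff[of "-1" "\<lambda>z. std_normal_density z * max (c - \<mu> - s * z) 0" i 0] that
      by (simp add: normal_density_def)
    from has_bochner_integral_add[OF that this] show ?thesis
      by (simp add: distrib_left)
  qed
  have "max (d - \<sigma> * z) 0 + max (d + \<sigma> * z) 0 \<le> max (d - \<sigma>' * z) 0 + max (d + \<sigma>' * z) 0" for d z :: real
  proof (cases "0 \<le> z")
    case True
    then have "\<sigma> * z \<le> \<sigma>' * z" "0 \<le> \<sigma> * z" using assms by (auto intro: mult_right_mono)
    then show ?thesis by (auto simp: max_def)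
  next
    case False
    then have "\<sigma>' * z \<le> \<sigma> * z" "\<sigma> * z \<le> 0"
      using assms by (auto intro: mult_right_mono_neg simp: mult_nonneg_nonpos)
    then show ?thesis by (auto simp: max_def)
  qed
  note le = this
  have \<sigma>': "0 < \<sigma>'" using assms(2,5) by simp
  note I = sym[OF expected_shortfall_gaussian[OF assms(1,2) X, of c]] and I' = sym[OF expected_shortfall_gaussian[OF assms(4) \<sigma>' X', of c]]
  have "2 * (\<integral>\<omega>. max (c - X \<omega>) 0 \<partial>M) \<le> 2 * (\<integral>\<omega>. max (c - X' \<omega>) 0 \<partial>M')"
    unfolding has_bochner_integral_integral_eq[OF I, symmetric] has_bochner_integral_integral_eq[OF I', symmetric]
    by (intro integral_mono mult_left_mono le has_bochner_integral_integrable I I' integrable.intros[OF I] integrable.intros[OF I']) simp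
  then show ?thesis by simp
qed

lemma indep_gaussian_imp_indep_integrable:
  assumes "indep_gaussian M U \<mu> \<sigma>" "\<And>j. 0 < \<sigma> $ j"
  shows "indep_integrable_vector M U"
proof -
  interpret prob_space M using assms by (simp add: indep_gaussian_def)
  have "integrable M (\<lambda>\<omega>. U \<omega> $ j)" for j
    using assms distributed_integrable_var[of M "\<lambda>\<omega>. U \<omega> $ j" "normal_density (\<mu> $ j) (\<sigma> $ j)"]
      integrable_normal_moment_nz_1[of "\<sigma> $ j"] by (simp add: indep_gaussian_def)
  with assms show ?thesis
    by (unfold_locales) (auto simp: indep_gaussian_def)
qed

lemma psi_gaussian_mono:
  assumes "indep_gaussian M U \<mu> \<sigma>" "indep_gaussian M' U' \<mu> \<sigma>'" "\<And>j. 0 < \<sigma> $ j" "\<And>j. \<sigma> $ j \<le> \<sigma>' $ j"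
  shows "psi M U c \<le> psi M' U' c"
  using assms by (auto simp: psi_def less_eq_vec_def indep_gaussian_def intro!: expected_shortfall_gaussian_mono[where \<sigma>="\<sigma> $ _" and \<sigma>'="\<sigma>' $ _"])

section \<open>The integrated density\<close>

text \<open>The interval integral runs over the open interval from the infimum of \<open>J\<close>, which may be infinite
and may or may not belong to \<open>J\<close>. Passing to \<open>J \<inter> {..t}\<close> changes at most the two end points and
removes the case distinction.\<close>

lemma interval_integral_eq_integral_below:
  fixes k :: "real \<Rightarrow> real" and J :: "real set"
  assumes J: "is_interval J" and l: "l = (INF t\<in>J. ereal t)" and k: "k absolutely_integrable_on J" and t: "t \<in> J"
  shows "k absolutely_integrable_on J \<inter> {..t}"
    and "(LINT s=l..ereal t|lebesgue. k s) = integral (J \<inter> {..t}) k"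
proof -
  have "l \<le> t" unfolding l by (intro INF_lower t)
  have sub: "einterval l t \<subseteq> J \<inter> {..t}"
  proof
    fix s assume s: "s \<in> einterval l t"
    then obtain u where "u \<in> J" "u < s"
      unfolding l einterval_def by (auto simp: INF_less_iff)
    with s t J show "s \<in> J \<inter> {..t}"
      by (auto simp: einterval_def intro: mem_is_interval_1_I[of J u t s])
  qed
  \<comment> \<open>For infinite \<open>l\<close> the second point is 0, a harmless surplus point.\<close>
  have "s \<in> {t, real_of_ereal l}" if "s \<in> (J \<inter> {..t}) - einterval l t" for s
  proof -
    have "l \<le> s" unfolding l using that by (intro INF_lower) auto
    then show ?thesis
      using that by (cases l) (auto simp: einterval_def)
  qed
  then have "{s \<in> (J \<inter> {..t}) - einterval l t. k s \<noteq> 0} \<subseteq> {t, real_of_ereal l}"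
    by blast
  then have neg: "negligible {s \<in> (J \<inter> {..t}) - einterval l t. k s \<noteq> 0}"
    by (rule negligible_subset[rotated]) simp
  have neg': "negligible {s \<in> einterval l t - (J \<inter> {..t}). k s \<noteq> 0}"
    using sub by (intro empty_imp_negligible) auto
  have int: "k absolutely_integrable_on einterval l t"
    using sub by (intro set_integrable_subset[OF k]) auto
  show "k absolutely_integrable_on J \<inter> {..t}"
    by (rule absolutely_integrable_spike_set[OF int neg' neg])
  have "(LINT s=l..ereal t|lebesgue. k s) = integral (einterval l t) k"
    using \<open>l \<le> t\<close> set_lebesgue_integral_eq_integral(2)[OF int] by (simp add: interval_lebesgue_integral_def)
  also have "\<dots> = integral (J \<inter> {..t}) k"
    by (rule integral_spike_set[OF neg' neg])
  finally show "(LINT s=l..ereal t|lebesgue. k s) = integral (J \<inter> {..t}) k" .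
qed

lemma interval_integral_diff:
  fixes k :: "real \<Rightarrow> real" and J :: "real set"
  assumes J: "is_interval J" and l: "l = (INF t\<in>J. ereal t)" and k: "k absolutely_integrable_on J"
    and ab: "a \<in> J" "b \<in> J" "a \<le> b"
  shows "(LINT s=l..ereal b|lebesgue. k s) - (LINT s=l..ereal a|lebesgue. k s) = integral {a..b} k"
proof -
  have sub: "{a..b} \<subseteq> J"
    using mem_is_interval_1_I[OF J ab(1,2)] by auto
  have eq: "J \<inter> {..b} = (J \<inter> {..a}) \<union> {a..b}"
    using sub \<open>a \<le> b\<close> by fastforce
  have neg: "(J \<inter> {..a}) \<inter> {a..b} = {a}"
    using ab by fastforce
  have "k integrable_on J \<inter> {..a}" "k integrable_on {a..b}"
    using interval_integral_eq_integral_below(1)[OF J l k ab(1)] absolutely_integrable_on_subinterval[OF k sub]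
    by (auto intro: set_lebesgue_integral_eq_integral(1))
  then have "integral (J \<inter> {..b}) k = integral (J \<inter> {..a}) k + integral {a..b} k"
    unfolding eq by (intro integral_Un) (simp_all add: neg)
  then show ?thesis
    using interval_integral_eq_integral_below(2)[OF J l k] ab by simp
qed

section \<open>Strict positivity\<close>

lemma set_integral_pos:
  fixes K :: "'a::euclidean_space \<Rightarrow> real"
  assumes K: "K absolutely_integrable_on S" and S: "S \<in> sets lebesgue" "0 < emeasure lebesgue S"
    and nonneg: "\<And>y. y \<in> S \<Longrightarrow> 0 \<le> K y" and pos: "AE y in lebesgue. y \<in> S \<longrightarrow> 0 < K y"
  shows "0 < (LINT y:S|lebesgue. K y)"
proof -
  let ?f = "\<lambda>y. indicator S y *\<^sub>R K y"
  have int: "integrable lebesgue ?f" and f: "\<And>y. 0 \<le> ?f y"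
    using K nonneg by (auto simp: set_integrable_def indicator_def)
  have "integral\<^sup>L lebesgue ?f \<noteq> 0"
  proof
    assume "integral\<^sup>L lebesgue ?f = 0"
    then have "AE y in lebesgue. ?f y = 0"
      using integral_nonneg_eq_0_iff_AE[OF int] f by simp
    with pos have "AE y in lebesgue. y \<notin> S"
      by eventually_elim (auto simp: indicator_def)
    then have "emeasure lebesgue S = 0"
      using S(1) by (simp add: AE_iff_null_sets null_setsD1)
    with S(2) show False by simp
  qed
  moreover have "0 \<le> integral\<^sup>L lebesgue ?f"
    using f by (intro integral_nonneg_AE) auto
  ultimately show ?thesis
    by (simp add: set_lebesgue_integral_def)
qed

lemma AE_prod_density_pos:
  fixes k :: "'m::finite \<Rightarrow> real \<Rightarrow> real"
  assumes "\<And>j. AE s in lebesgue. s \<in> J j \<longrightarrow> 0 < k j s"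
  shows "AE y in lebesgue. (\<forall>j. (y :: real ^ 'm) $ j \<in> J j) \<longrightarrow> 0 < prod_density k y"
proof -
  have "AE y in lebesgue. (y :: real ^ 'm) $ j \<in> J j \<longrightarrow> 0 < k j (y $ j)" for j
  proof -
    obtain N where N: "{s. \<not> (s \<in> J j \<longrightarrow> 0 < k j s)} \<subseteq> N" "N \<in> null_sets lebesgue"
      using assms[of j] by (auto simp: eventually_ae_filter)
    then have "{y :: real ^ 'm. y $ j \<in> N} \<in> null_sets lebesgue"
      using negligible_vec_preimage by (simp add: negligible_iff_null_sets)
    then show ?thesis
      using N(1) by (auto simp: eventually_ae_filter intro!: bexI[of _ "{y :: real ^ 'm. y $ j \<in> N}"])
  qed
  then have "AE y in lebesgue. \<forall>j. (y :: real ^ 'm) $ j \<in> J j \<longrightarrow> 0 < k j (y $ j)"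
    by (simp add: AE_all_countable)
  then show ?thesis
    by eventually_elim (auto simp: prod_density_def intro: prod_pos)
qed

section \<open>Transport, exact computation and monotonicity of weighted hypervolumes\<close>

theorem theorem4p1:
  fixes r :: "real ^ 'm"
    and l :: "'m \<Rightarrow> ereal"
    and J :: "'m \<Rightarrow> real set"
    and k :: "'m \<Rightarrow> real \<Rightarrow> real"
    and K :: "real ^ 'm \<Rightarrow> real"
    and T :: "real ^ 'm \<Rightarrow> real ^ 'm"
    and X :: "(real ^ 'm) set"
  assumes J_interval: "\<And>j. is_interval (J j)"
    and J_lower: "\<And>j. l j = (INF t\<in>J j. ereal t)"
    and l_less: "\<And>j. l j < ereal (r $ j)"
    and J_upper: "\<And>j t. t \<in> J j \<Longrightarrow> t \<le> r $ j"
    and r_in_J: "\<And>j. r $ j \<in> J j"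
    and k_L1: "\<And>j. k j absolutely_integrable_on J j"
    and k_nonneg: "\<And>j s. s \<in> J j \<Longrightarrow> 0 \<le> k j s"
    and k_pos: "\<And>j. AE s in lebesgue. s \<in> J j \<longrightarrow> 0 < k j s"
  defines "K \<equiv> prod_density k"
    and "T \<equiv> cumul l k"
    and "X \<equiv> {y. \<forall>j. y $ j \<in> J j}"
  shows
    "(\<forall>A. finite A \<and> A \<subseteq> X \<longrightarrow> WHV K r A = HV (T r) (T ` A))
   \<and> (\<forall>A (M :: 'a measure) U \<mu> \<sigma>.
        finite A \<and> A \<subseteq> X \<and> (\<forall>j. 0 < \<sigma> $ j) \<and> indep_gaussian M U \<mu> \<sigma> \<longrightarrow>
        expected_HVI M U (T r) (T ` A) =
          HV (psi M U (T r)) (psi M U ` T ` A \<union> {0}) - HV (psi M U (T r)) (psi M U ` T ` A))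
   \<and> (\<forall>A B. finite A \<and> A \<subseteq> X \<and> finite B \<and> B \<subseteq> X \<and>
        Dom r B \<subseteq> Dom r A \<and> 0 < emeasure lebesgue (Dom r A - Dom r B) \<longrightarrow>
        WHV K r A > WHV K r B)
   \<and> (\<forall>A (M :: 'a measure) U (M' :: 'b measure) U' \<mu> \<sigma> \<sigma>'.
        finite A \<and> A \<subseteq> X \<and> (\<forall>j. 0 < \<sigma> $ j) \<and> (\<forall>j. \<sigma>' $ j \<ge> \<sigma> $ j) \<and>
        indep_gaussian M U \<mu> \<sigma> \<and> indep_gaussian M' U' \<mu> \<sigma>' \<longrightarrow>
        expected_HVI M' U' (T r) (T ` A) \<ge> expected_HVI M U (T r) (T ` A))"
proof -
  have X_sup: "sup a b \<in> X" if "a \<in> X" "b \<in> X" for a b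
    using that by (auto simp: X_def sup_vec_def sup_max max_def)
  have X_le: "a $ j \<le> r $ j" if "a \<in> X" for a j
    using that J_upper by (simp add: X_def)
  have subJ: "{a $ j..r $ j} \<subseteq> J j" if "a \<in> X" for a j
    using mem_is_interval_1_I[OF J_interval, of "a $ j" j "r $ j"] r_in_J that by (auto simp: X_def)
  have T_diff: "T b $ j - T a $ j = integral {a $ j..b $ j} (k j)"
    if "a $ j \<in> J j" "b $ j \<in> J j" "a $ j \<le> b $ j" for a b j
    using interval_integral_diff[OF J_interval J_lower k_L1 that] by (simp add: T_def cumul_def)
  have T_mono: "T a $ j \<le> T b $ j" if ab: "a $ j \<in> J j" "b $ j \<in> J j" "a $ j \<le> b $ j" for a b j
  proof -
    have "{a $ j..b $ j} \<subseteq> J j"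
      using mem_is_interval_1_I[OF J_interval ab(1,2)] by auto
    then have "0 \<le> integral {a $ j..b $ j} (k j)"
      using k_nonneg absolutely_integrable_on_subinterval[OF k_L1]
      by (intro integral_nonneg) (auto intro: set_lebesgue_integral_eq_integral(1))
    then show ?thesis using T_diff[OF ab] by simp
  qed
  have T_sup: "T (sup a b) = sup (T a) (T b)" if "a \<in> X" "b \<in> X" for a b
    unfolding T_def cumul_def
  proof (rule vec_lambda_sup[where S = J])
    show "mono_on (J j) (\<lambda>t. LINT s=l j..ereal t|lebesgue. k j s)" for j
      using T_mono[of "\<chi> _. x" j "\<chi> _. y" for x y] by (auto simp: mono_on_def T_def cumul_def)
  qed (use that in \<open>auto simp: X_def\<close>)
  have T_le: "T ` A \<subseteq> {..T r}" if "A \<subseteq> X" for A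
    using that X_le r_in_J T_mono[of _ _ r] by (auto simp: less_eq_vec_def X_def subset_iff)
  have k_box: "k j absolutely_integrable_on {a $ j..r $ j}" if "a \<in> X" for a j
    using absolutely_integrable_on_subinterval[OF k_L1 subJ[OF that]] .
  have K_box: "K absolutely_integrable_on cbox a r" if "a \<in> X" for a
    unfolding K_def by (rule prod_density_box(1)) (rule k_box[OF that])
  have K_Dom: "K absolutely_integrable_on Dom r A" if "finite A" "A \<subseteq> X" for A
    using that K_box by (intro absolutely_integrable_on_Dom) auto
  have transport: "WHV K r A = HV (T r) (T ` A)" if "finite A" "A \<subseteq> X" for A
    using that
  proof (induction A rule: sup_image_induct)
    case empty
    show ?case by (simp add: WHV_def set_lebesgue_integral_def)
  next
    case (singleton a)
    then have aJ: "a $ j \<in> J j" for j by (simp add: X_def)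
    have "integral {a $ j..r $ j} (k j) = max (T r $ j - T a $ j) 0" for j
      using T_mono[OF aJ r_in_J X_le[OF singleton]]
      unfolding T_diff[OF aJ r_in_J X_le[OF singleton], symmetric] by simp
    then show ?case
      using prod_density_box(2)[OF k_box[OF singleton]]
      by (simp add: WHV_def K_def HV_singleton)
  next
    case (insert a A)
    have "WHV K r (insert a A) = WHV K r {a} + WHV K r A - WHV K r (sup a ` A)"
      using insert.hyps K_box by (intro WHV_insert) auto
    moreover have "T ` sup a ` A = sup (T a) ` T ` A"
      using T_sup insert.hyps by (auto simp: image_image subset_iff intro!: image_cong)
    ultimately show ?case
      using HV_insert[of "T ` A" "T r" "T a"] insert by simp
  qed (rule X_sup)
  \<comment> \<open>The two regions differ by a set of positive measure inside the domain of the density, where \<open>K\<close> is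
    positive almost everywhere.\<close>
  have strict: "WHV K r A > WHV K r B"
    if A: "finite A" "A \<subseteq> X" and B: "finite B" "B \<subseteq> X" and sub: "Dom r B \<subseteq> Dom r A"
      and pos: "0 < emeasure lebesgue (Dom r A - Dom r B)" for A B
  proof -
    let ?S = "Dom r A - Dom r B"
    have meas: "?S \<in> sets lebesgue"
      using A(1) B(1) by (auto simp: lmeasurable_Dom fmeasurableD)
    have K_S: "K absolutely_integrable_on ?S"
      by (rule set_integrable_subset[OF K_Dom[OF A] meas]) auto
    have in_J: "y $ j \<in> J j" if y: "y \<in> ?S" for y j
    proof -
      obtain a where "a \<in> A" "y \<in> cbox a r" using y by (auto simp: Dom_def)
      then have "y $ j \<in> {a $ j..r $ j}" "a \<in> X" using A(2) by (auto simp: mem_box_cart)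
      then show ?thesis using subJ by blast
    qed
    have "0 < (LINT y:?S|lebesgue. K y)"
    proof (rule set_integral_pos[OF K_S meas pos])
      show "0 \<le> K y" if y: "y \<in> ?S" for y
        using in_J[OF y] k_nonneg by (auto simp: K_def prod_density_def intro!: prod_nonneg)
      show "AE y in lebesgue. y \<in> ?S \<longrightarrow> 0 < K y"
        using AE_prod_density_pos[OF k_pos] by eventually_elim (use in_J in \<open>auto simp: K_def\<close>)
    qed
    moreover have "WHV K r A = WHV K r B + (LINT y:?S|lebesgue. K y)"
      using set_integral_Un[OF _ K_Dom[OF B] K_S] sub by (simp add: WHV_def Un_absorb1)
    ultimately show ?thesis by simp
  qed
  show ?thesis
  proof (intro conjI allI impI; (elim conjE)?)
    fix A :: "(real ^ 'm) set" and M :: "'a measure" and U and \<mu> \<sigma> :: "real ^ 'm"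
    assume A: "finite A" "A \<subseteq> X" and U: "\<forall>j. 0 < \<sigma> $ j" "indep_gaussian M U \<mu> \<sigma>"
    interpret indep_integrable_vector M U
      using indep_gaussian_imp_indep_integrable[OF U(2)] U(1) by simp
    have "HV (psi M U (T r)) (psi M U ` T ` A \<union> {0}) = HV (psi M U (T r)) {0}"
      using A(1) psi_nonneg by (intro HV_Un_zero) auto
    then show "expected_HVI M U (T r) (T ` A) =
        HV (psi M U (T r)) (psi M U ` T ` A \<union> {0}) - HV (psi M U (T r)) (psi M U ` T ` A)"
      using expected_HVI_eq[OF _ T_le[OF A(2)]] A(1) by simp
  next
    fix A :: "(real ^ 'm) set" and M :: "'a measure" and U and M' :: "'b measure" and U' and \<mu> \<sigma> \<sigma>' :: "real ^ 'm"
    assume A: "finite A" "A \<subseteq> X" and \<sigma>: "\<forall>j. 0 < \<sigma> $ j" "\<forall>j. \<sigma> $ j \<le> \<sigma>' $ j"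
      and U: "indep_gaussian M U \<mu> \<sigma>" and U': "indep_gaussian M' U' \<mu> \<sigma>'"
    have \<sigma>': "0 < \<sigma>' $ j" for j
      using \<sigma> by (meson order_less_le_trans)
    show "expected_HVI M U (T r) (T ` A) \<le> expected_HVI M' U' (T r) (T ` A)"
      using A(1) T_le[OF A(2)] \<sigma> \<sigma>'
      by (intro expected_HVI_mono indep_gaussian_imp_indep_integrable[OF U]
          indep_gaussian_imp_indep_integrable[OF U'] psi_gaussian_mono[OF U U']) auto
  qed (use transport strict in auto)
qed

end
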